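(* Let $k,t$ be integers with $k=t^2\ge 9$, and let $H$ be a subgraph of the star $K_{1,\lceil (k-3)/2\rceil}$ with $|E(H)|\ge 4$. Then $$\operatorname{bi-GM}_{k-2}(P_5:H)=t^2(t-1)^2(t-2)-9(t-1)(t-2).$$
   Context: All graphs are finite, simple and without isolated vertices. $P_n$ is the path on $n$ vertices; $K_{m,n}$ is the complete bipartite graph. A $k$-edge-coloring of a graph is a map from its edge set onto $\{1,\dots,k\}$ that is exact, i.e. every one of the $k$ colors is used at least once. An edge-colored graph is rainbow if all its edges have distinct colors and monochromatic if all its edges have the same color. A copy of a graph $F$ in a graph $G$ is a subgraph of $G$ isomorphic to $F$; distinct copies are distinct subgraphs. For non-empty bipartite graphs $G,H$ and a positive integer $k$, the bipartite Gallai-Ramsey number $\operatorname{bgr}_k(G:H)$ is the minimum integer $N$ such that for all $n\ge N$, every (exact) $k$-edge-coloring of $K_{n,n}$ contains a rainbow copy of $G$ or a monochromatic copy of $H$. The bipartite Gallai-Ramsey multiplicity $\operatorname{bi-GM}_k(G:H)$ is the minimum, over all (exact) $k$-edge-colorings of $K_{N,N}$ with $N=\operatorname{bgr}_k(G:H)$, of the total number of rainbow copies of $G$ plus monochromatic copies of $H$.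
   Formalization: The bipartite Gallai-Ramsey number is taken over N with N² at least the number of colors, since otherwise it holds vacuously for small N and bi-GM is a minimum over the empty set; t is taken nonnegative, as for negative t the right-hand side is negative. *)

theory Defs
  imports Complex_Main
begin

type_synonym 'a ugraph = "'a set \<times> 'a set set"

abbreviation vertices :: "'a ugraph \<Rightarrow> 'a set" where "vertices G \<equiv> fst G"
abbreviation edges :: "'a ugraph \<Rightarrow> 'a set set" where "edges G \<equiv> snd G"

text \<open>The last conjunct says that there are no isolated vertices; as all graphs are of this kind,
  so are all subgraphs and hence all copies counted below.\<close>

definition is_graph :: "'a ugraph \<Rightarrow> bool" where
  "is_graph G \<longleftrightarrow> finite (vertices G)
     \<and> (\<forall>e\<in>edges G. e \<subseteq> vertices G \<and> card e = 2)
     \<and> (\<forall>v\<in>vertices G. \<exists>e\<in>edges G. v \<in> e)"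

definition subgraph_of :: "'a ugraph \<Rightarrow> 'a ugraph \<Rightarrow> bool" where
  "subgraph_of F G \<longleftrightarrow> is_graph F \<and> is_graph G \<and> vertices F \<subseteq> vertices G \<and> edges F \<subseteq> edges G"

definition graph_iso :: "'a ugraph \<Rightarrow> 'b ugraph \<Rightarrow> bool" where
  "graph_iso F G \<longleftrightarrow>
     (\<exists>f. bij_betw f (vertices F) (vertices G) \<and> (\<lambda>e. f ` e) ` edges F = edges G)"

definition copies :: "'a ugraph \<Rightarrow> 'b ugraph \<Rightarrow> 'b ugraph set" where
  "copies F G = {F'. subgraph_of F' G \<and> graph_iso F F'}"

definition path_graph :: "nat \<Rightarrow> nat ugraph" where
  "path_graph n = ({..<n}, {{i, Suc i} | i. Suc i < n})"

definition complete_bipartite :: "nat \<Rightarrow> nat \<Rightarrow> (nat + nat) ugraph" where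
  "complete_bipartite m n =
     (Inl ` {..<m} \<union> Inr ` {..<n}, {{Inl i, Inr j} | i j. i < m \<and> j < n})"

text \<open>A coloring is a total function of which only the values on the edges matter.\<close>

definition exact_coloring :: "nat \<Rightarrow> 'a ugraph \<Rightarrow> ('a set \<Rightarrow> nat) \<Rightarrow> bool" where
  "exact_coloring k G c \<longleftrightarrow> c ` edges G = {1..k}"

definition rainbow :: "('a set \<Rightarrow> nat) \<Rightarrow> 'a ugraph \<Rightarrow> bool" where
  "rainbow c F \<longleftrightarrow> inj_on c (edges F)"

definition monochromatic :: "('a set \<Rightarrow> nat) \<Rightarrow> 'a ugraph \<Rightarrow> bool" where
  "monochromatic c F \<longleftrightarrow> (\<exists>a. \<forall>e\<in>edges F. c e = a)"

definition rainbow_copies :: "('b set \<Rightarrow> nat) \<Rightarrow> 'a ugraph \<Rightarrow> 'b ugraph \<Rightarrow> 'b ugraph set" where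
  "rainbow_copies c F K = {F' \<in> copies F K. rainbow c F'}"

definition monochromatic_copies :: "('b set \<Rightarrow> nat) \<Rightarrow> 'a ugraph \<Rightarrow> 'b ugraph \<Rightarrow> 'b ugraph set" where
  "monochromatic_copies c F K = {F' \<in> copies F K. monochromatic c F'}"

text \<open>The condition \<open>k \<le> N\<^sup>2\<close> says that \<open>K\<^bsub>N,N\<^esub>\<close> has an exact \<open>k\<close>-edge-coloring at all. Without it
  the property required of \<open>N\<close> could hold vacuously for small \<open>N\<close>, and the multiplicity
  below would be a minimum over the empty set.\<close>

definition bgr :: "nat \<Rightarrow> 'a ugraph \<Rightarrow> 'b ugraph \<Rightarrow> nat" where
  "bgr k G H = (LEAST N. k \<le> N\<^sup>2 \<and>
     (\<forall>n\<ge>N. \<forall>c. exact_coloring k (complete_bipartite n n) c \<longrightarrow>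
        rainbow_copies c G (complete_bipartite n n) \<noteq> {} \<or>
        monochromatic_copies c H (complete_bipartite n n) \<noteq> {}))"

definition bi_GM :: "nat \<Rightarrow> 'a ugraph \<Rightarrow> 'b ugraph \<Rightarrow> nat" where
  "bi_GM k G H =
     (let K = complete_bipartite (bgr k G H) (bgr k G H) in
      INF c \<in> {c. exact_coloring k K c}.
        card (rainbow_copies c G K) + card (monochromatic_copies c H K))"

end

theory Submission
  imports Defs
begin

text \<open>
  Write \<open>q = k - 2\<close>. A coloring of \<open>K\<^bsub>n,n\<^esub>\<close> with at least nine colors and no rainbow \<open>P\<^sub>5\<close> has at most
  \<open>n + 1\<close> colors, and some color occupies at least half of the edges at some vertex: a vertex seeing
  at least five colors leaves its companions either a copy of its own row or only two colors, three
  or four colors at a vertex are impossible, and if every vertex sees at most two colors then the color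
  sets of the rows pairwise intersect. So every exact \<open>q\<close>-coloring contains one of the required
  copies, and the bipartite Gallai-Ramsey number is the least \<open>N\<close> with \<open>q \<le> N\<^sup>2\<close>, namely \<open>t\<close>.

  In \<open>K\<^bsub>t,t\<^esub>\<close> there are only two more edges than colors, so no four edges share a color and \<open>H\<close> never
  occurs monochromatically, while at most three pairs of edges share a color. Two edges
  lie on at most \<open>3(t - 1)(t - 2)\<close> common copies of \<open>P\<^sub>5\<close>. A repeated color on a star \<open>K\<^bsub>1,3\<^esub>\<close> attains the
  resulting bound \<open>9(t - 1)(t - 2)\<close> on non-rainbow copies, because no path contains three edges at a vertex.
\<close>

section \<open>Colorings without a rainbow path on five vertices\<close>

text \<open>The matrix entry \<open>m x y\<close> is the color of the edge joining the \<open>x\<close>-th left and the \<open>y\<close>-th right vertex.\<close>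

locale rainbow_P5_free =
  fixes n :: nat and m :: "nat \<Rightarrow> nat \<Rightarrow> nat"
  assumes rows_path: "\<And>x1 x2 x3 y1 y2.
      \<lbrakk>x1 < n; x2 < n; x3 < n; y1 < n; y2 < n; distinct [x1, x2, x3]; y1 \<noteq> y2\<rbrakk>
      \<Longrightarrow> \<not> distinct [m x1 y1, m x2 y1, m x2 y2, m x3 y2]"
    and columns_path: "\<And>x1 x2 y1 y2 y3.
      \<lbrakk>x1 < n; x2 < n; y1 < n; y2 < n; y3 < n; distinct [y1, y2, y3]; x1 \<noteq> x2\<rbrakk>
      \<Longrightarrow> \<not> distinct [m x1 y1, m x1 y2, m x2 y2, m x2 y3]"
begin

definition row :: "nat \<Rightarrow> nat set" where "row x = m x ` {..<n}"
definition column :: "nat \<Rightarrow> nat set" where "column y = (\<lambda>x. m x y) ` {..<n}"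
definition colours :: "nat set" where "colours = (\<Union>x<n. row x)"
text \<open>Half of a line suffices: at most \<open>n + 1\<close> colors occur, so for
  \<open>q\<close> colors half of a line amounts to at least \<open>(q - 1) / 2\<close> edges, while
  the stars needed have at most \<open>q / 2\<close> edges.\<close>

definition heavy_row :: bool where
  "heavy_row \<longleftrightarrow> (\<exists>x<n. \<exists>a. n \<le> 2 * card {y. y < n \<and> m x y = a})"
definition heavy_column :: bool where
  "heavy_column \<longleftrightarrow> (\<exists>y<n. \<exists>a. n \<le> 2 * card {x. x < n \<and> m x y = a})"

lemma finite_row [simp]: "finite (row x)" and finite_column [simp]: "finite (column y)"
  and finite_colours [simp]: "finite colours"
  by (auto simp: row_def column_def colours_def)

lemma in_row [intro]: "y < n \<Longrightarrow> m x y \<in> row x"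
  by (auto simp: row_def)

lemma rowE: assumes "a \<in> row x" obtains y where "y < n" "m x y = a"
  using assms by (auto simp: row_def)

lemma coloursE: assumes "a \<in> colours" obtains x y where "x < n" "y < n" "m x y = a"
  using assms by (auto simp: row_def colours_def)

text \<open>Transposition exchanges the two path conditions, so each fact about rows also yields one
  about columns.\<close>

lemma transpose: "rainbow_P5_free n (\<lambda>x y. m y x)"
proof
  show "\<not> distinct [m y1 x1, m y1 x2, m y2 x2, m y2 x3]"
    if "x1 < n" "x2 < n" "x3 < n" "y1 < n" "y2 < n" "distinct [x1, x2, x3]" "y1 \<noteq> y2"
    for x1 x2 x3 y1 y2
    using columns_path[of y1 y2 x1 x2 x3] that by auto
  show "\<not> distinct [m y1 x1, m y2 x1, m y2 x2, m y3 x2]"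
    if "x1 < n" "x2 < n" "y1 < n" "y2 < n" "y3 < n" "distinct [y1, y2, y3]" "x1 \<noteq> x2"
    for x1 x2 y1 y2 y3
    using rows_path[of y1 y2 y3 x1 x2] that by auto
qed

section \<open>Rows with many colors\<close>

lemma two_avoiding:
  assumes "finite A" "card B + 2 \<le> card A" "finite B"
  obtains a b where "a \<in> A - B" "b \<in> A - B" "a \<noteq> b"
proof -
  have "2 \<le> card (A - B)"
    using diff_card_le_card_Diff[OF assms(3), of A] assms by linarith
  then obtain C where "C \<subseteq> A - B" "card C = 2"
    by (meson obtain_subset_with_card_n)
  then show ?thesis using that by (auto simp: card_2_iff)
qed

lemma two_columns_avoiding:
  assumes "card B + 2 \<le> card (row x)" "finite B"
  obtains y z where "y < n" "z < n" "m x y \<notin> B" "m x z \<notin> B" "m x y \<noteq> m x z"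
proof -
  obtain a b where "a \<in> row x - B" "b \<in> row x - B" "a \<noteq> b"
    using two_avoiding[OF finite_row assms] .
  then show ?thesis using that unfolding row_def by blast
qed

lemma two_coloured_row_heavy:
  assumes "x < n" "row x \<subseteq> {a, b}"
  shows heavy_row
proof -
  let ?A = "\<lambda>c. {y. y < n \<and> m x y = c}"
  have "{..<n} \<subseteq> ?A a \<union> ?A b" using assms in_row[of _ x] by blast
  then have "n \<le> card (?A a \<union> ?A b)"
    using card_mono[of "?A a \<union> ?A b" "{..<n}"] by simp
  also have "\<dots> \<le> card (?A a) + card (?A b)" by (rule card_Un_le)
  finally have "n \<le> 2 * card (?A a) \<or> n \<le> 2 * card (?A b)" by linarith
  then show ?thesis using assms(1) unfolding heavy_row_def by blast
qed

text \<open>An entry \<open>c\<close> of row \<open>x'\<close> starts a path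
  \<open>y' - x' - y - x - y2\<close> with colors \<open>c\<close>, \<open>m x' y\<close>,
  \<open>m x y\<close>, \<open>e\<close>. Five colors in row \<open>x\<close> leave two choices of
  \<open>e\<close>, and \<open>c\<close> cannot equal both.\<close>

lemma row_dichotomy:
  assumes "x < n" "x' < n" "y < n" "5 \<le> card (row x)" "m x' y \<noteq> m x y"
  shows "row x' \<subseteq> {m x y, m x' y}"
proof
  fix c assume "c \<in> row x'"
  then obtain y' where y': "y' < n" "m x' y' = c" by (rule rowE)
  show "c \<in> {m x y, m x' y}"
  proof (cases "y' = y")
    case True
    then show ?thesis using y' by auto
  next
    case False
    \<comment> \<open>Avoiding \<open>m x y'\<close> as well keeps the last column of the path
      different from \<open>y'\<close>.\<close>
    have "card {m x y, m x' y, m x y'} + 2 \<le> card (row x)"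
      using assms(4) card_insert_le_m1 by (auto simp: card_insert_if)
    then obtain b b' where b: "b \<in> row x - {m x y, m x' y, m x y'}"
      "b' \<in> row x - {m x y, m x' y, m x y'}" "b \<noteq> b'"
      using two_avoiding[OF finite_row] by blast
    have "c \<in> {m x y, m x' y, e}" if e: "e \<in> row x - {m x y, m x' y, m x y'}" for e
    proof -
      obtain y2 where "y2 < n" "m x y2 = e" using e by (auto elim: rowE)
      moreover from this have "distinct [y', y, y2]" "x' \<noteq> x" using e False assms(5) by auto
      ultimately have "\<not> distinct [c, m x' y, m x y, e]"
        using columns_path[of x' x y' y y2] y' assms(1-3) by blast
      then show ?thesis using e assms(5) by auto
    qed
    from this[OF b(1)] this[OF b(2)] show ?thesis using b(3) by auto
  qed
qed

text \<open>Applying \<open>row_dichotomy\<close> at two columns where row \<open>x\<close> has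
  different colors confines row \<open>x'\<close> to two pairs of colors whose only common element
  is the missing color.\<close>

lemma row_of_missing_colour:
  assumes "x < n" "x' < n" "y < n" "5 \<le> card (row x)" "m x' y \<notin> row x"
  shows "row x' = {m x' y}"
proof -
  have ne: "m x' y' \<noteq> m x y''" if "y'' < n" "m x' y' = m x' y" for y' y''
    using that assms by auto
  have sub: "row x' \<subseteq> {m x y, m x' y}"
    using row_dichotomy assms ne by blast
  have "card {m x y} + 2 \<le> card (row x)" using assms by simp
  then obtain y2 y3 where y23: "y2 < n" "y3 < n" "m x y2 \<notin> {m x y}" "m x y3 \<notin> {m x y}" "m x y2 \<noteq> m x y3"
    using two_columns_avoiding by blast
  define b b' where "b = m x y2" and "b' = m x y3"
  then have b: "b \<in> row x - {m x y}" "b' \<in> row x - {m x y}" "b \<noteq> b'"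
    and y: "y2 < n" "m x y2 = b" "y3 < n" "m x y3 = b'"
    using y23 by auto
  \<comment> \<open>Otherwise this entry is \<open>m x y\<close>, and the path
    \<open>y - x' - y2 - x - y3\<close> is rainbow.\<close>
  have "m x' y2 = m x' y"
  proof (rule ccontr)
    assume "m x' y2 \<noteq> m x' y"
    then have "m x' y2 = m x y" using sub in_row[OF y(1), of x'] by blast
    moreover have "x' \<noteq> x" "y \<noteq> y2" "y \<noteq> y3" "y2 \<noteq> y3"
      using y23 ne[of y y] assms(3) by auto
    moreover have "m x' y \<noteq> m x y" "m x' y \<noteq> m x y2" "m x' y \<noteq> m x y3"
      using ne y23(1,2) assms(3) by blast+
    ultimately show False
      using columns_path[of x' x y y2 y3] assms(1-3) y23 by simp
  qed
  then have "row x' \<subseteq> {b, m x' y}"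
    using row_dichotomy[of x x' y2] assms(1,2,4) y(1,2) ne[of y2 y2] by simp
  then show ?thesis using sub b in_row[OF assms(3), of x'] by blast
qed

text \<open>Row \<open>x\<close> has at most \<open>n\<close> colors and misses at most one. Either
  all rows agree with row \<open>x\<close>, which makes the columns constant, or some row differs
  and has at most two colors.\<close>

lemma many_coloured_row:
  assumes "x < n" "5 \<le> card (row x)"
  shows "card colours \<le> n + 1" and "heavy_row \<or> heavy_column"
proof -
  have "card (colours - row x) \<le> 1"
  proof (rule ccontr)
    assume "\<not> card (colours - row x) \<le> 1"
    then obtain d e where de: "d \<in> colours - row x" "e \<in> colours - row x" "d \<noteq> e"
      by (metis card_le_Suc0_iff_eq One_nat_def finite_Diff finite_colours)
    then obtain x' y' where x': "x' < n" "y' < n" "m x' y' = d"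
      using coloursE by blast
    obtain x'' y'' where x'': "x'' < n" "y'' < n" "m x'' y'' = e"
      using coloursE de(2) by blast
    have r: "row x' = {d}" "row x'' = {e}"
      using row_of_missing_colour[OF assms(1) x'(1,2) assms(2)]
        row_of_missing_colour[OF assms(1) x''(1,2) assms(2)] de x'(3) x''(3) by simp_all
    obtain y z where y: "y < n" "z < n" "m x y \<noteq> m x z"
      using two_columns_avoiding[of "{}" x] assms by auto
    have yz: "m x' y = d" "m x'' z = e" using r in_row[OF y(1), of x'] in_row[OF y(2), of x''] by simp_all
    have "m x y \<noteq> d" "m x z \<noteq> d" "m x y \<noteq> e" "m x z \<noteq> e" "x' \<noteq> x" "x'' \<noteq> x" "x' \<noteq> x''"
      using de in_row[OF y(1), of x] in_row[OF y(2), of x] r by auto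
    \<comment> \<open>The path \<open>x' - y - x - z - x''\<close> carries \<open>d\<close>, two
      different colors of row \<open>x\<close>, and \<open>e\<close>.\<close>
    then show False
      using rows_path[of x' x x'' y z] x'(1) x''(1) y yz assms(1) de(3) by auto
  qed
  moreover have "card (row x) \<le> n"
    unfolding row_def using card_image_le[of "{..<n}"] by force
  moreover have "card colours \<le> card (colours - row x) + card (row x)"
    using card_Un_le[of "colours - row x" "row x"] card_mono[of "colours \<union> row x" colours] by auto
  ultimately show "card colours \<le> n + 1" by linarith
  show "heavy_row \<or> heavy_column"
  proof (cases "\<forall>x'<n. \<forall>y<n. m x' y = m x y")
    case True
    \<comment> \<open>Any column would do; the index \<open>x\<close> is reused because it is known
      to be below \<open>n\<close>.\<close>
    then have "{x'. x' < n \<and> m x' x = m x x} = {..<n}" using assms(1) by blast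
    then have "n \<le> 2 * card {x'. x' < n \<and> m x' x = m x x}" by simp
    then have heavy_column unfolding heavy_column_def using assms(1) by blast
    then show ?thesis ..
  next
    case False
    then obtain x' y where "x' < n" "y < n" "m x' y \<noteq> m x y" by blast
    then show ?thesis
      using row_dichotomy[of x x' y] two_coloured_row_heavy[of x'] assms by blast
  qed
qed

text \<open>The bound on two rows together supplies a color \<open>d\<close> outside row
  \<open>x\<close>, found in some row \<open>x'\<close>, and a color \<open>e\<close> outside both
  rows. A third color in row \<open>x\<close> then leaves no admissible entry in row
  \<open>x'\<close>.\<close>

lemma row_three_colours:
  assumes "x < n" "3 \<le> card (row x)" "\<And>x'. x' < n \<Longrightarrow> card (row x) + card (row x') < card colours"
  shows False
proof -
  have sub: "\<exists>d. d \<in> colours - A" if "finite A" "card A < card colours" for A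
    using that by (metis Diff_eq_empty_iff all_not_in_conv card_mono not_less)
  have "card (row x) < card colours" using assms(1,3) by fastforce
  then obtain d where d: "d \<in> colours - row x" using sub finite_row by blast
  then obtain x' y where x': "x' < n" "y < n" "m x' y = d" using coloursE by blast
  have "card (row x \<union> row x') < card colours"
    using assms(3)[OF x'(1)] card_Un_le[of "row x" "row x'"] by linarith
  then obtain e where e: "e \<in> colours - (row x \<union> row x')"
    using sub[of "row x \<union> row x'"] by auto
  then obtain x'' z where x'': "x'' < n" "z < n" "m x'' z = e" using coloursE by blast
  define a where "a = m x y"
  have ne: "x' \<noteq> x" "x'' \<noteq> x" "x'' \<noteq> x'" "d \<noteq> e" "\<And>u. u < n \<Longrightarrow> d \<noteq> m x u" "\<And>u. u < n \<Longrightarrow> e \<noteq> m x u"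
    using d e x' x'' in_row by blast+
  \<comment> \<open>Otherwise \<open>x' - y - x - z - x''\<close> is a rainbow path.\<close>
  have az: "m x z = a"
  proof (rule ccontr)
    assume "m x z \<noteq> a"
    moreover from this have "y \<noteq> z" unfolding a_def by blast
    ultimately show False
      using rows_path[of x' x x'' y z] x' x'' ne(1-4) assms(1)
        ne(5,6)[OF x'(2)] ne(5,6)[OF x''(2)] unfolding a_def by simp
  qed
  have "card {a} + 2 \<le> card (row x)" using assms by simp
  then obtain y2 y3 where y23: "y2 < n" "y3 < n" "m x y2 \<notin> {a}" "m x y3 \<notin> {a}" "m x y2 \<noteq> m x y3"
    using two_columns_avoiding by blast
  define b b' where "b = m x y2" and "b' = m x y3"
  then have b: "b \<in> row x - {a}" "b' \<in> row x - {a}" "b \<noteq> b'"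
    and y: "y2 < n" "m x y2 = b" "y3 < n" "m x y3 = b'"
    using y23 by auto
  have ne': "a \<noteq> b" "a \<noteq> b'" "y \<noteq> y2" "y \<noteq> y3" "y2 \<noteq> y3" "z \<noteq> y2" "d \<noteq> a" "d \<noteq> b" "d \<noteq> b'" "e \<noteq> a" "e \<noteq> b" "e \<noteq> b'"
    using b y az ne(5,6) x'(2) unfolding a_def by blast+
  \<comment> \<open>The paths \<open>y - x' - y2 - x - y3\<close> and
    \<open>x'' - z - x - y2 - x'\<close> force \<open>m x' y2 = b\<close>. Then
    \<open>y2 - x' - y - x - y3\<close> has the four colors \<open>b\<close>, \<open>d\<close>,
    \<open>a\<close>, \<open>b'\<close>.\<close>
  have distinct: "distinct [y, y2, y3]" "distinct [x'', x, x']" "x' \<noteq> x" "z \<noteq> y2" "distinct [y2, y, y3]"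
    using ne(1-3) ne' by auto
  note columns_path[OF x'(1) assms(1) x'(2) y(1,3) distinct(1,3)]
  then have "m x' y2 \<in> {d, b, b'}"
    unfolding x'(3) y(2,4) using ne'(8,9) b(3) by auto
  moreover note rows_path[OF x''(1) assms(1) x'(1) x''(2) y(1) distinct(2,4)]
  then have "m x' y2 \<in> {e, a, b}"
    unfolding x''(3) y(2) az using ne'(1,10,11) by auto
  ultimately have "m x' y2 = b" using ne(4) ne'(2,7,8,12) b(3) by auto
  moreover have "m x y = a" by (simp add: a_def)
  moreover have "distinct [b, d, a, b']" using ne' b(3) by auto
  ultimately show False
    using columns_path[OF x'(1) assms(1) y(1) x'(2) y(3) distinct(5,3)] unfolding x'(3) y(4) by simp
qed

section \<open>Rows and columns with at most two colors\<close>

lemma row_pair: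
  assumes "a \<in> row x" "card (row x) \<le> 2"
  shows "\<exists>b. row x = {a, b}"
proof (cases "row x = {a}")
  case False
  then obtain b where "b \<in> row x" "b \<noteq> a" using assms(1) by blast
  moreover from this have "card (row x) \<le> card {a, b}" using assms(2) by simp
  ultimately have "{a, b} = row x" using assms(1) by (intro card_seteq) auto
  then show ?thesis by blast
qed blast

lemma two_coloured_lines:
  assumes rows: "\<And>x. x < n \<Longrightarrow> card (row x) \<le> 2" and columns: "\<And>y. y < n \<Longrightarrow> card (column y) \<le> 2"
    and "5 \<le> card colours"
  shows "card colours \<le> n + 1"
proof -
  \<comment> \<open>If rows \<open>x\<close> and \<open>x'\<close> share no color, they already show
    two colors in every column, so no color lies outside them and there are at most four.\<close>
  have meet: "row x \<inter> row x' \<noteq> {}" if "x < n" "x' < n" for x x'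
  proof
    assume dis: "row x \<inter> row x' = {}"
    have "colours \<subseteq> row x \<union> row x'"
    proof
      fix c assume "c \<in> colours"
      then obtain u y where u: "u < n" "y < n" "m u y = c" by (rule coloursE)
      have "m x y \<noteq> m x' y" using dis in_row[OF u(2), of x] in_row[OF u(2), of x'] by auto
      moreover have "{m x y, m x' y, c} \<subseteq> column y" using that u by (auto simp: column_def)
      moreover have "card {m x y, m x' y, c} \<le> 2"
        using columns[OF u(2)] card_mono[OF finite_column calculation(2)] by linarith
      ultimately have "c \<in> {m x y, m x' y}" by (auto simp: card_insert_if split: if_splits)
      then show "c \<in> row x \<union> row x'" using in_row[OF u(2)] by auto
    qed
    then have "card colours \<le> card (row x \<union> row x')" by (simp add: card_mono)
    then show False
      using card_Un_le[of "row x" "row x'"] rows[OF that(1)] rows[OF that(2)] assms(3) by linarith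
  qed
  have pair: "\<exists>b. row x = {a, b}" if "x < n" "a \<in> row x" for x a
    using row_pair[OF that(2) rows[OF that(1)]] .
  \<comment> \<open>Pairwise intersecting sets of at most two elements have a common element unless
    they contain a triangle \<open>{a, b}\<close>, \<open>{b, c}\<close>, \<open>{a, c}\<close>. A
    triangle admits no fourth color.\<close>
  have "\<exists>a. \<forall>x<n. a \<in> row x"
  proof (rule ccontr)
    assume no: "\<nexists>a. \<forall>x<n. a \<in> row x"
    obtain c where "c \<in> colours" using assms(3) by fastforce
    then obtain x0 where x0: "x0 < n" using coloursE by blast
    obtain a b where ab: "row x0 = {a, b}" using pair[OF x0 in_row[OF x0]] by blast
    obtain x1 where x1: "x1 < n" "a \<notin> row x1" using no by blast
    obtain x2 where x2: "x2 < n" "b \<notin> row x2" using no by blast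
    have "b \<in> row x1" using meet[OF x0 x1(1)] ab x1(2) by auto
    then obtain c where r1: "row x1 = {b, c}" using pair[OF x1(1)] by blast
    have "a \<in> row x2" using meet[OF x0 x2(1)] ab x2(2) by auto
    moreover have "c \<in> row x2" using meet[OF x1(1) x2(1)] r1 x2(2) by auto
    moreover have "a \<noteq> c" using r1 x1(2) by auto
    ultimately have r2: "row x2 = {a, c}" using pair[OF x2(1), of a] by auto
    have "colours \<subseteq> {a, b, c}"
    proof (rule ccontr)
      assume "\<not> colours \<subseteq> {a, b, c}"
      then obtain x d where x: "x < n" "d \<in> row x" "d \<notin> {a, b, c}"
        unfolding colours_def by blast
      obtain e where "row x = {d, e}" using pair[OF x(1,2)] by blast
      then have "e \<in> {a, b}" "e \<in> {b, c}" "e \<in> {a, c}"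
        using meet[OF x0 x(1)] meet[OF x1(1) x(1)] meet[OF x2(1) x(1)] ab r1 r2 x(3) by auto
      then show False using x1(2) x2(2) r1 r2 by auto
    qed
    then have "card colours \<le> card {a, b, c}" by (simp add: card_mono)
    then show False using assms(3) card_length[of "[a, b, c]"] by simp
  qed
  then obtain a where a: "\<And>x. x < n \<Longrightarrow> a \<in> row x" by blast
  \<comment> \<open>Besides the common color \<open>a\<close>, each row contributes at most one
    color.\<close>
  have "\<forall>x\<in>{..<n}. \<exists>b. row x = {a, b}" using pair a by blast
  then obtain f where f: "\<forall>x\<in>{..<n}. row x = {a, f x}" by (rule bchoice[THEN exE])
  then have "colours \<subseteq> insert a (f ` {..<n})" by (auto simp: colours_def)
  then have "card colours \<le> card (insert a (f ` {..<n}))" by (simp add: card_mono)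
  also have "\<dots> \<le> Suc (card (f ` {..<n}))" by (simp add: card_insert_if)
  also have "\<dots> \<le> n + 1" using card_image_le[of "{..<n}" f] by simp
  finally show ?thesis .
qed

text \<open>The cases are a row or column with at least five colors, one with three or four, and
  none with more than two.\<close>

lemma heavy_star:
  assumes "9 \<le> card colours"
  shows "card colours \<le> n + 1" and "heavy_row \<or> heavy_column"
proof -
  interpret T: rainbow_P5_free n "\<lambda>x y. m y x" by (rule transpose)
  have T: "T.row = column" "T.column = row" "T.heavy_row = heavy_column" "T.heavy_column = heavy_row"
    by (auto simp: T.row_def column_def T.column_def row_def T.heavy_row_def heavy_column_def
        T.heavy_column_def heavy_row_def)
  have Tc: "T.colours = colours"
    by (auto simp: T.colours_def colours_def T.row_def row_def)
  have "card colours \<le> n + 1 \<and> (heavy_row \<or> heavy_column)"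
  proof (cases "\<exists>x<n. 5 \<le> card (row x) \<or> 5 \<le> card (column x)")
    case True
    then show ?thesis
      using many_coloured_row T.many_coloured_row[unfolded T Tc] by blast
  next
    case False
    then have le4: "card (row x) \<le> 4" "card (column x) \<le> 4" if "x < n" for x
      using that by fastforce+
    have row2: "card (row x) \<le> 2" if "x < n" for x
    proof (rule ccontr)
      assume "\<not> card (row x) \<le> 2"
      then have "3 \<le> card (row x)" by simp
      \<comment> \<open>This is where nine colors are required: two rows have at most 4 + 4
        colors.\<close>
      moreover have "card (row x) + card (row x') < card colours" if "x' < n" for x'
        using le4(1)[OF \<open>x < n\<close>] le4(1)[OF that] assms by linarith
      ultimately show False by (rule row_three_colours[OF that])
    qed
    have column2: "card (column x) \<le> 2" if "x < n" for x
    proof (rule ccontr)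
      assume "\<not> card (column x) \<le> 2"
      then have "3 \<le> card (column x)" by simp
      moreover have "card (column x) + card (column x') < card colours" if "x' < n" for x'
        using le4(2)[OF \<open>x < n\<close>] le4(2)[OF that] assms by linarith
      ultimately show False by (rule T.row_three_colours[OF that, unfolded T Tc])
    qed
    have "colours \<noteq> {}" using assms by auto
    then have "0 < n" by (auto simp: colours_def)
    then obtain b where "row 0 = {m 0 0, b}" using row_pair[OF in_row row2] by blast
    then show ?thesis
      using two_coloured_row_heavy[OF \<open>0 < n\<close>] two_coloured_lines[OF row2 column2] assms by auto
  qed
  then show "card colours \<le> n + 1" and "heavy_row \<or> heavy_column" by auto
qed

end

section \<open>Counting paths on five vertices as zigzags of cells\<close>

text \<open>\<open>((y1, y2), (x1, x2, x3))\<close> encodes the path \<open>x1 - y1 - x2 - y2 - x3\<close>; requiring \<open>y1 < y2\<close> selects one of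
  its two directions. Paths with two left and three right vertices are the zigzags of the transposed matrix.\<close>

definition zigzag :: "(nat \<times> nat) \<times> (nat \<times> nat \<times> nat) \<Rightarrow> (nat \<times> nat) set" where
  "zigzag = (\<lambda>((y1, y2), (x1, x2, x3)). {(x1, y1), (x2, y1), (x2, y2), (x3, y2)})"

definition zigzags :: "nat \<Rightarrow> ((nat \<times> nat) \<times> (nat \<times> nat \<times> nat)) set" where
  "zigzags n = {((y1, y2), (x1, x2, x3)).
     y1 < y2 \<and> y2 < n \<and> x1 < n \<and> x2 < n \<and> x3 < n \<and> distinct [x1, x2, x3]}"

lemma zigzags_product:
  "zigzags n = {(y1, y2). y1 < y2 \<and> y2 < n} \<times>
     (SIGMA x1:{..<n}. SIGMA x2:{..<n} - {x1}. {..<n} - {x1, x2})"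
  by (auto simp: zigzags_def)

lemma finite_less_pairs [simp]: "finite {(y1 :: nat, y2). y1 < y2 \<and> y2 < n}"
  by (rule finite_subset[of _ "{..<n} \<times> {..<n}"]) auto

lemma finite_zigzags [simp]: "finite (zigzags n)"
  by (simp add: zigzags_product)

lemma card_less_pairs: "2 * card {(y1 :: nat, y2). y1 < y2 \<and> y2 < n} = n * (n - 1)"
proof (induction n)
  case (Suc n)
  have "{(y1, y2). y1 < y2 \<and> y2 < Suc n} = {(y1, y2). y1 < y2 \<and> y2 < n} \<union> {..<n} \<times> {n}"
    by auto
  then have "card {(y1, y2). y1 < y2 \<and> y2 < Suc n} = card {(y1, y2). y1 < y2 \<and> y2 < n} + n"
    by (simp add: card_Un_disjoint disjoint_iff card_cartesian_product)
  then show ?case using Suc by (cases n) auto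
qed simp

lemma card_distinct_triples:
  "card (SIGMA x1:{..<n :: nat}. SIGMA x2:{..<n} - {x1}. {..<n} - {x1, x2}) = n * (n - 1) * (n - 2)"
proof -
  have "card (SIGMA x2:{..<n} - {x1}. {..<n} - {x1, x2}) = (n - 1) * (n - 2)" if "x1 < n" for x1
  proof -
    have "card ({..<n} - {x1, x2}) = n - 2" if "x2 \<in> {..<n} - {x1}" for x2
      using that \<open>x1 < n\<close> by (subst card_Diff_subset) auto
    then show ?thesis using that by (simp add: card_SigmaI numeral_2_eq_2)
  qed
  then show ?thesis by (simp add: card_SigmaI numeral_2_eq_2)
qed

text \<open>The factor 2 accounts for the transposed zigzags; the right-hand side is the number of
  all copies of the path in \<open>complete_bipartite n n\<close>.\<close>

lemma card_zigzags: "2 * card (zigzags n) = n\<^sup>2 * (n - 1)\<^sup>2 * (n - 2)"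
  unfolding zigzags_product card_cartesian_product card_distinct_triples mult.assoc[symmetric]
    card_less_pairs power2_eq_square
  by (simp add: mult_ac)

lemma zigzag_subset: "\<tau> \<in> zigzags n \<Longrightarrow> zigzag \<tau> \<subseteq> {..<n} \<times> {..<n}"
  by (auto simp: zigzags_def zigzag_def)

text \<open>The occupied columns give \<open>y1 < y2\<close>; the rows occupied in them are
  \<open>{x1, x2}\<close> and \<open>{x2, x3}\<close>, which meet only in \<open>x2\<close>.\<close>

lemma inj_on_zigzag: "inj_on zigzag (zigzags n)"
proof
  fix \<sigma> \<tau> assume *: "\<sigma> \<in> zigzags n" "\<tau> \<in> zigzags n" "zigzag \<sigma> = zigzag \<tau>"
  obtain y1 y2 x1 x2 x3 where s: "\<sigma> = ((y1, y2), (x1, x2, x3))" by (metis surj_pair)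
  obtain v1 v2 u1 u2 u3 where t: "\<tau> = ((v1, v2), (u1, u2, u3))" by (metis surj_pair)
  have d: "y1 < y2" "v1 < v2" "distinct [x1, x2, x3]" "distinct [u1, u2, u3]"
    using * by (auto simp: s t zigzags_def)
  have e: "{(x1, y1), (x2, y1), (x2, y2), (x3, y2)} = {(u1, v1), (u2, v1), (u2, v2), (u3, v2)}"
    using *(3) by (simp add: s t zigzag_def)
  from arg_cong[OF e, of "image snd"] have "{y1, y2} = {v1, v2}" by simp
  then have y: "y1 = v1" "y2 = v2" using d(1,2) by (auto simp: doubleton_eq_iff)
  from arg_cong[OF e, of "\<lambda>C. {x. (x, y1) \<in> C}"] have "{x1, x2} = {u1, u2}" using y d(1) by auto
  moreover from arg_cong[OF e, of "\<lambda>C. {x. (x, y2) \<in> C}"] have "{x2, x3} = {u2, u3}" using y d(1) by auto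
  ultimately show "\<sigma> = \<tau>" using d(3,4) y by (auto simp: s t doubleton_eq_iff)
qed

text \<open>A zigzag occupies three rows, a transposed one only two.\<close>

lemma zigzag_neq_swap: "\<sigma> \<in> zigzags n \<Longrightarrow> \<tau> \<in> zigzags n \<Longrightarrow> zigzag \<sigma> \<noteq> prod.swap ` zigzag \<tau>"
proof
  assume *: "\<sigma> \<in> zigzags n" "\<tau> \<in> zigzags n" "zigzag \<sigma> = prod.swap ` zigzag \<tau>"
  have "card (fst ` zigzag \<sigma>) = 3" using *(1) by (auto simp: zigzags_def zigzag_def)
  moreover have "card (snd ` zigzag \<tau>) = 2" using *(2) by (auto simp: zigzags_def zigzag_def)
  ultimately show False using *(3) by (simp add: image_image)
qed

text \<open>One representative of each color leaves two elements \<open>u\<close> and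
  \<open>v\<close>. A collision pairs one of them with its equally colored representative or with
  the other.\<close>

lemma colliding_pairs:
  assumes "finite A" "card A = card (m ` A) + 2"
  obtains P where "finite P" "card P \<le> 3" "\<And>e f. (e, f) \<in> P \<Longrightarrow> e \<in> A \<and> f \<in> A \<and> e \<noteq> f"
    "\<And>C. C \<subseteq> A \<Longrightarrow> \<not> inj_on m C \<Longrightarrow> \<exists>(e, f)\<in>P. e \<in> C \<and> f \<in> C"
proof -
  obtain S where S: "S \<subseteq> A" "inj_on m S" "m ` A = m ` S"
    using subset_image_inj[of "m ` A" m A] by auto
  have "card (A - S) = 2"
    using assms S card_image[OF S(2)] by (simp add: card_Diff_subset finite_subset)
  then obtain u v where uv: "A - S = {u, v}" "u \<noteq> v" by (auto simp: card_2_iff)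
  then have "m u \<in> m ` S" "m v \<in> m ` S" using S(3) by blast+
  then obtain s r where sr: "s \<in> S" "m s = m u" "r \<in> S" "m r = m v" by (metis imageE)
  \<comment> \<open>The pair \<open>(u, v)\<close> is listed whether or not its colors agree, since
    only an upper bound is sought.\<close>
  let ?P = "{(u, s), (v, r), (u, v)}"
  show thesis
  proof (rule that[of ?P])
    show "card ?P \<le> 3" using card_length[of "[(u, s), (v, r), (u, v)]"] by simp
    show "e \<in> A \<and> f \<in> A \<and> e \<noteq> f" if "(e, f) \<in> ?P" for e f
      using that uv sr S(1) by blast
    show "\<exists>(e, f)\<in>?P. e \<in> C \<and> f \<in> C" if C: "C \<subseteq> A" "\<not> inj_on m C" for C
    proof -
      obtain e f where ef: "e \<in> C" "f \<in> C" "e \<noteq> f" "m e = m f" using C(2) by (auto simp: inj_on_def)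
      have "(e \<in> S \<or> e = u \<or> e = v) \<and> (f \<in> S \<or> f = u \<or> f = v)" using ef C(1) uv(1) by blast
      moreover have "g = h" if "g \<in> S" "h \<in> S" "m g = m h" for g h
        using S(2) that by (meson inj_onD)
      ultimately show ?thesis using ef sr by (smt (verit) case_prod_conv insertCI)
    qed
  qed simp
qed

section \<open>Paths through two given cells\<close>

definition zigzags_through :: "nat \<Rightarrow> nat \<times> nat \<Rightarrow> nat \<times> nat \<Rightarrow> ((nat \<times> nat) \<times> (nat \<times> nat \<times> nat)) set" where
  "zigzags_through n e f = {\<tau> \<in> zigzags n. e \<in> zigzag \<tau> \<and> f \<in> zigzag \<tau>}"

lemma zigzags_through_commute: "zigzags_through n e f = zigzags_through n f e"
  by (auto simp: zigzags_through_def)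

lemma card_delete2: "p < n \<Longrightarrow> p' < n \<Longrightarrow> p \<noteq> p' \<Longrightarrow> card ({..<n :: nat} - {p, p'}) = n - 2"
  by (subst card_Diff_subset) auto

text \<open>Only the middle row of a zigzag contains two of its cells, so the columns and
  \<open>x2\<close> are fixed and only \<open>x1\<close> and \<open>x3\<close> vary.\<close>

lemma card_through_same_row:
  assumes "p < n" "q < q'"
  shows "card (zigzags_through n (p, q) (p, q')) \<le> (n - 1) * (n - 2)"
proof -
  let ?D = "SIGMA x1:{..<n} - {p}. {..<n} - {p, x1}"
  have "zigzags_through n (p, q) (p, q') \<subseteq> (\<lambda>(x1, x3). ((q, q'), (x1, p, x3))) ` ?D"
    using assms by (auto simp: zigzags_through_def zigzags_def zigzag_def)
  then have "card (zigzags_through n (p, q) (p, q')) \<le> card ?D"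
    by (intro surj_card_le) auto
  also have "card ?D = (n - 1) * (n - 2)"
    using assms(1) card_delete2[of p n] by (simp add: card_SigmaI numeral_2_eq_2)
  finally show ?thesis .
qed

lemma card_through_same_column:
  assumes "p < n" "p' < n" "p \<noteq> p'" "q < n"
  shows "card (zigzags_through n (p, q) (p', q)) \<le> 2 * ((n - 1) * (n - 2))"
proof -
  let ?D = "{(p, p'), (p', p)} \<times> ({..<n} - {q}) \<times> ({..<n} - {p, p'})"
  \<comment> \<open>Here \<open>a\<close>, \<open>b\<close> are the two given rows in path order,
    \<open>y\<close> is the other column and \<open>x\<close> the third row; comparing
    \<open>q\<close> with \<open>y\<close> tells which column comes first.\<close>
  let ?f = "\<lambda>((a, b), (y, x)). if q < y then ((q, y), (a, b, x)) else ((y, q), (x, a, b))"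
  have "\<exists>d\<in>?D. \<tau> = ?f d" if "\<tau> \<in> zigzags_through n (p, q) (p', q)" for \<tau>
  proof -
    obtain y1 y2 x1 x2 x3 where t: "\<tau> = ((y1, y2), (x1, x2, x3))" by (metis surj_pair)
    have h: "y1 < y2" "y2 < n" "x1 < n" "x3 < n" "distinct [x1, x2, x3]"
      and pq: "(p, q) \<in> zigzag \<tau>" "(p', q) \<in> zigzag \<tau>"
      using that by (auto simp: t zigzags_through_def zigzags_def)
    have "q = y1 \<or> q = y2" using pq by (auto simp: t zigzag_def)
    then show ?thesis
    proof
      assume "q = y1"
      moreover then have "(p, p') = (x1, x2) \<or> (p, p') = (x2, x1)"
        using pq h assms(3) by (auto simp: t zigzag_def)
      ultimately show ?thesis using h t by (intro bexI[of _ "((x1, x2), (y2, x3))"]) auto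
    next
      assume "q = y2"
      moreover then have "(p, p') = (x2, x3) \<or> (p, p') = (x3, x2)"
        using pq h assms(3) by (auto simp: t zigzag_def)
      ultimately show ?thesis using h t by (intro bexI[of _ "((x2, x3), (y1, x1))"]) auto
    qed
  qed
  then have "zigzags_through n (p, q) (p', q) \<subseteq> ?f ` ?D" unfolding image_def by blast
  then have "card (zigzags_through n (p, q) (p', q)) \<le> card ?D"
    by (intro surj_card_le[of _ _ ?f]) auto
  also have "card ?D = 2 * ((n - 1) * (n - 2))"
    using assms card_delete2[of p n p'] by (simp add: card_cartesian_product)
  finally show ?thesis .
qed

text \<open>Both columns are determined, and two of the three row positions are taken by
  \<open>p\<close> and \<open>p'\<close> in an order fixed by the columns.\<close>

lemma card_through_disjoint:
  assumes "p < n" "p' < n" "p \<noteq> p'" "q \<noteq> q'"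
  shows "card (zigzags_through n (p, q) (p', q')) \<le> 3 * (n - 2)"
proof -
  have *: "card (zigzags_through n (p, q) (p', q')) \<le> 3 * (n - 2)"
    if "p < n" "p' < n" "p \<noteq> p'" "q < q'" for p p' q q'
  proof -
    let ?D = "{..<n} - {p, p'}"
    let ?A = "(\<lambda>x. ((q, q'), (p, p', x))) ` ?D" and ?B = "(\<lambda>x. ((q, q'), (p, x, p'))) ` ?D"
      and ?C = "(\<lambda>x. ((q, q'), (x, p, p'))) ` ?D"
    have "zigzags_through n (p, q) (p', q') \<subseteq> ?A \<union> ?B \<union> ?C"
      using that by (auto simp: zigzags_through_def zigzags_def zigzag_def)
    then have "card (zigzags_through n (p, q) (p', q')) \<le> card (?A \<union> ?B \<union> ?C)"
      by (intro card_mono) auto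
    also have "\<dots> \<le> card ?A + card ?B + card ?C"
      by (meson add_le_mono1 card_Un_le order_trans)
    also have "\<dots> \<le> 3 * card ?D"
      using card_image_le[of ?D "\<lambda>x. ((q, q'), (p, p', x))"]
        card_image_le[of ?D "\<lambda>x. ((q, q'), (p, x, p'))"]
        card_image_le[of ?D "\<lambda>x. ((q, q'), (x, p, p'))"] by simp
    finally show ?thesis using that card_delete2 by simp
  qed
  show ?thesis
    using *[of p p' q q'] *[of p' p q' q] assms zigzags_through_commute
    by (metis linorder_neq_iff)
qed

text \<open>Transposition turns a common row into a common column, so adjacent edges give 1 + 2
  multiples of \<open>(n - 1) * (n - 2)\<close>. Disjoint edges give at most
  \<open>6 * (n - 2)\<close>, which is no more because \<open>n\<close> is at least 3.\<close>

lemma card_through_pair: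
  assumes "3 \<le> n" "e \<in> {..<n} \<times> {..<n}" "f \<in> {..<n} \<times> {..<n}" "e \<noteq> f"
  shows "card (zigzags_through n e f) + card (zigzags_through n (prod.swap e) (prod.swap f))
           \<le> 3 * ((n - 1) * (n - 2))"
proof -
  obtain p q p' q' where ef: "e = (p, q)" "f = (p', q')" by (metis surj_pair)
  have lt: "p < n" "q < n" "p' < n" "q' < n" using assms ef by auto
  have row: "card (zigzags_through n (p, q) (p, q')) \<le> (n - 1) * (n - 2)"
    if "p < n" "q \<noteq> q'" for p q q'
    using card_through_same_row[OF that(1)] that(2) zigzags_through_commute by (metis linorder_neq_iff)
  consider "p = p'" "q \<noteq> q'" | "p \<noteq> p'" "q = q'" | "p \<noteq> p'" "q \<noteq> q'" using assms(4) ef by auto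
  then show ?thesis
  proof cases
    case 1
    then show ?thesis using row[of p q q'] card_through_same_column[of q n q' p] lt by (simp add: ef)
  next
    case 2
    then show ?thesis using row[of q p p'] card_through_same_column[of p n p' q] lt by (simp add: ef)
  next
    case 3
    have "2 * (n - 2) \<le> (n - 1) * (n - 2)" using assms(1) by (intro mult_right_mono) auto
    then show ?thesis
      using 3 card_through_disjoint[of p n p' q q'] card_through_disjoint[of q n q' p p'] lt
      unfolding ef swap_simp by linarith
  qed
qed

lemma inj_on_comp_swap: "inj_on (m \<circ> prod.swap) C \<longleftrightarrow> inj_on m (prod.swap ` C)"
  by (simp add: comp_inj_on_iff[symmetric])

text \<open>A union bound over the at most three pairs from \<open>colliding_pairs\<close>, each
  weighted by \<open>card_through_pair\<close>.\<close>

lemma repeated_zigzags_le: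
  assumes "3 \<le> n" "n\<^sup>2 = card (m ` ({..<n} \<times> {..<n})) + 2"
  shows "card {\<tau> \<in> zigzags n. \<not> inj_on m (zigzag \<tau>)}
           + card {\<tau> \<in> zigzags n. \<not> inj_on (m \<circ> prod.swap) (zigzag \<tau>)} \<le> 9 * ((n - 1) * (n - 2))"
proof -
  let ?A = "{..<n} \<times> {..<n}"
  obtain P where P: "finite P" "card P \<le> 3" "\<And>e f. (e, f) \<in> P \<Longrightarrow> e \<in> ?A \<and> f \<in> ?A \<and> e \<noteq> f"
    "\<And>C. C \<subseteq> ?A \<Longrightarrow> \<not> inj_on m C \<Longrightarrow> \<exists>(e, f)\<in>P. e \<in> C \<and> f \<in> C"
    using colliding_pairs[of ?A m] assms(2) by (auto simp: card_cartesian_product power2_eq_square)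
  let ?N = "\<lambda>(e, f). zigzags_through n e f"
  let ?N' = "\<lambda>(e, f). zigzags_through n (prod.swap e) (prod.swap f)"
  have fin: "finite (?N d)" "finite (?N' d)" for d
    by (auto simp: zigzags_through_def split: prod.split)
  have "{\<tau> \<in> zigzags n. \<not> inj_on m (zigzag \<tau>)} \<subseteq> (\<Union>d\<in>P. ?N d)"
    using P(4)[OF zigzag_subset] by (fastforce simp: zigzags_through_def)
  then have 1: "card {\<tau> \<in> zigzags n. \<not> inj_on m (zigzag \<tau>)} \<le> (\<Sum>d\<in>P. card (?N d))"
    using card_UN_le[OF P(1), of ?N] card_mono[OF finite_UN_I[OF P(1) fin(1)]] by (meson order_trans)
  have "{\<tau> \<in> zigzags n. \<not> inj_on (m \<circ> prod.swap) (zigzag \<tau>)} \<subseteq> (\<Union>d\<in>P. ?N' d)"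
  proof
    fix \<tau> assume t: "\<tau> \<in> {\<tau> \<in> zigzags n. \<not> inj_on (m \<circ> prod.swap) (zigzag \<tau>)}"
    moreover from this have "prod.swap ` zigzag \<tau> \<subseteq> ?A" using zigzag_subset by fastforce
    ultimately obtain e f where "(e, f) \<in> P" "e \<in> prod.swap ` zigzag \<tau>" "f \<in> prod.swap ` zigzag \<tau>"
      using P(4)[of "prod.swap ` zigzag \<tau>"] unfolding inj_on_comp_swap by blast
    then show "\<tau> \<in> (\<Union>d\<in>P. ?N' d)" using t by (force simp: zigzags_through_def)
  qed
  then have 2: "card {\<tau> \<in> zigzags n. \<not> inj_on (m \<circ> prod.swap) (zigzag \<tau>)} \<le> (\<Sum>d\<in>P. card (?N' d))"
    using card_UN_le[OF P(1), of ?N'] card_mono[OF finite_UN_I[OF P(1) fin(2)]] by (meson order_trans)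
  have "(\<Sum>d\<in>P. card (?N d)) + (\<Sum>d\<in>P. card (?N' d)) = (\<Sum>d\<in>P. card (?N d) + card (?N' d))"
    by (rule sum.distrib[symmetric])
  also have "\<dots> \<le> of_nat (card P) * (3 * ((n - 1) * (n - 2)))"
    using P(3) card_through_pair[OF assms(1)] by (intro sum_bounded_above) fastforce
  also have "\<dots> \<le> 3 * (3 * ((n - 1) * (n - 2)))" using P(2) by (intro mult_right_mono) auto
  finally show ?thesis using 1 2 by simp
qed

text \<open>The two injections count 3 choices of a column pair around the middle row 0, and 6
  ordered pairs of star leaves in the transposed zigzags.\<close>

lemma repeated_zigzags_star:
  assumes "3 \<le> n" "m (0, 0) = a" "m (0, 1) = a" "m (0, 2) = a"
  shows "9 * ((n - 1) * (n - 2)) \<le> card {\<tau> \<in> zigzags n. \<not> inj_on m (zigzag \<tau>)}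
           + card {\<tau> \<in> zigzags n. \<not> inj_on (m \<circ> prod.swap) (zigzag \<tau>)}"
proof -
  let ?S = "{(0, 1), (0, 2), (1, 2 :: nat)} :: (nat \<times> nat) set"
  let ?D = "?S \<times> (SIGMA x1:{..<n} - {0}. {..<n} - {0, x1})"
  let ?f = "\<lambda>(s, (x1, x3)). (s, (x1, 0 :: nat, x3 :: nat))"
  have "card ?D = 3 * ((n - 1) * (n - 2))"
    using assms(1) card_delete2[of 0 n]
    by (simp add: card_cartesian_product card_SigmaI numeral_2_eq_2 numeral_3_eq_3)
  moreover have "inj_on ?f ?D" by (auto simp: inj_on_def)
  moreover have "?f ` ?D \<subseteq> {\<tau> \<in> zigzags n. \<not> inj_on m (zigzag \<tau>)}"
    using assms by (auto simp: zigzags_def zigzag_def)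
  ultimately have 1: "3 * ((n - 1) * (n - 2)) \<le> card {\<tau> \<in> zigzags n. \<not> inj_on m (zigzag \<tau>)}"
    using card_mono[of "{\<tau> \<in> zigzags n. \<not> inj_on m (zigzag \<tau>)}" "?f ` ?D"] by (simp add: card_image)
  let ?T = "{(0, 1), (0, 2), (1, 2), (1, 0), (2, 0), (2, 1)} :: (nat \<times> nat) set"
  let ?E = "({..<n} - {0}) \<times> (SIGMA s:?T. {..<n} - {fst s, snd s})"
  \<comment> \<open>After transposition the star lies in column 0, which always comes first in the
    encoding.\<close>
  let ?g = "\<lambda>(y, (s, x)). ((0 :: nat, y :: nat), (fst s, snd s, x :: nat))"
  have "card ({..<n} - {fst s, snd s}) = n - 2" if "s \<in> ?T" for s
    using that assms(1) by (intro card_delete2) auto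
  then have "card (SIGMA s:?T. {..<n} - {fst s, snd s}) = (\<Sum>s\<in>?T. n - 2)"
    by (subst card_SigmaI) (auto intro!: sum.cong)
  then have "card ?E = 6 * ((n - 1) * (n - 2))"
    using assms(1) by (simp add: card_cartesian_product)
  moreover have "inj_on ?g ?E" by (auto simp: inj_on_def)
  moreover have "?g ` ?E \<subseteq> {\<tau> \<in> zigzags n. \<not> inj_on (m \<circ> prod.swap) (zigzag \<tau>)}"
    using assms by (auto simp: zigzags_def zigzag_def)
  ultimately have "6 * ((n - 1) * (n - 2)) \<le> card {\<tau> \<in> zigzags n. \<not> inj_on (m \<circ> prod.swap) (zigzag \<tau>)}"
    using card_mono[of "{\<tau> \<in> zigzags n. \<not> inj_on (m \<circ> prod.swap) (zigzag \<tau>)}" "?g ` ?E"]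
    by (simp add: card_image)
  with 1 show ?thesis by simp
qed

section \<open>Copies and the multiplicity\<close>

definition edge_of :: "nat \<times> nat \<Rightarrow> (nat + nat) set" where
  "edge_of = (\<lambda>(x, y). {Inl x, Inr y})"

text \<open>A graph without isolated vertices is determined by its edges, so a set of cells suffices
  to name a subgraph.\<close>

definition cell_graph :: "(nat \<times> nat) set \<Rightarrow> (nat + nat) ugraph" where
  "cell_graph C = (\<Union>(edge_of ` C), edge_of ` C)"

lemma inj_edge_of: "inj edge_of"
  by (auto simp: inj_def edge_of_def doubleton_eq_iff)

lemma inj_cell_graph: "inj cell_graph"
  by (auto simp: inj_def cell_graph_def inj_image_eq_iff[OF inj_edge_of])

lemma edges_complete_bipartite:
  "edges (complete_bipartite n n) = edge_of ` ({..<n} \<times> {..<n})"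
  by (auto simp: complete_bipartite_def edge_of_def)

lemma card_edges_complete_bipartite: "card (edges (complete_bipartite n n)) = n\<^sup>2"
  unfolding edges_complete_bipartite card_image[OF inj_on_subset[OF inj_edge_of subset_UNIV]]
  by (simp add: card_cartesian_product power2_eq_square)

lemma is_graph_complete_bipartite: "is_graph (complete_bipartite n n)"
proof -
  have "\<exists>e\<in>edges (complete_bipartite n n). v \<in> e" if "v \<in> vertices (complete_bipartite n n)" for v
  proof -
    have "v \<in> Inl ` {..<n} \<union> Inr ` {..<n}" using that by (simp add: complete_bipartite_def)
    then obtain i where "i < n" "v = Inl i \<or> v = Inr i" by blast
    then have "{Inl i, Inr i} \<in> edges (complete_bipartite n n)" "v \<in> {Inl i, Inr i}"
      by (auto simp: complete_bipartite_def)
    then show ?thesis by blast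
  qed
  then show ?thesis by (auto simp: is_graph_def complete_bipartite_def)
qed

lemma subgraph_of_cell_graph:
  assumes "C \<subseteq> {..<n} \<times> {..<n}"
  shows "subgraph_of (cell_graph C) (complete_bipartite n n)"
proof -
  have "finite C" using assms by (rule finite_subset) simp
  then have "is_graph (cell_graph C)"
    by (auto simp: is_graph_def cell_graph_def edge_of_def split: prod.splits)
  moreover have "vertices (cell_graph C) \<subseteq> vertices (complete_bipartite n n)"
    using assms by (auto simp: cell_graph_def edge_of_def complete_bipartite_def)
  moreover have "edges (cell_graph C) \<subseteq> edges (complete_bipartite n n)"
    using assms unfolding edges_complete_bipartite by (auto simp: cell_graph_def)
  ultimately show ?thesis by (simp add: subgraph_of_def is_graph_complete_bipartite)
qed

section \<open>Copies of the path on five vertices\<close>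

lemma vertices_P5: "vertices (path_graph 5) = {0, 1, 2, 3, 4}"
  by (auto simp: path_graph_def)

lemma edges_P5: "edges (path_graph 5) = {{0, 1}, {1, 2}, {2, 3}, {3, 4}}"
proof -
  have "(\<exists>i. P i \<and> Suc i < 5) \<longleftrightarrow> P 0 \<or> P 1 \<or> P 2 \<or> P 3" for P
    by (auto simp: less_Suc_eq numeral_eq_Suc)
  then show ?thesis by (auto simp: path_graph_def numeral_eq_Suc)
qed

lemma graph_iso_P5:
  assumes "distinct [v0, v1, v2, v3, v4]"
  shows "graph_iso (path_graph 5) ({v0, v1, v2, v3, v4}, {{v0, v1}, {v1, v2}, {v2, v3}, {v3, v4}})"
  unfolding graph_iso_def vertices_P5 edges_P5
  using assms
  by (intro exI[of _ "\<lambda>i. [v0, v1, v2, v3, v4] ! i"]) (auto simp: bij_betw_def)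

lemma graph_iso_P5E:
  assumes "graph_iso (path_graph 5) F"
  obtains v0 v1 v2 v3 v4 where "distinct [v0, v1, v2, v3, v4]"
    "F = ({v0, v1, v2, v3, v4}, {{v0, v1}, {v1, v2}, {v2, v3}, {v3, v4}})"
proof -
  obtain f where f: "bij_betw f {0, 1, 2, 3, 4 :: nat} (vertices F)"
    "(\<lambda>e. f ` e) ` {{0, 1}, {1, 2}, {2, 3}, {3, 4}} = edges F"
    using assms unfolding graph_iso_def vertices_P5 edges_P5 by blast
  show thesis
  proof (rule that[of "f 0" "f 1" "f 2" "f 3" "f 4"])
    show "distinct [f 0, f 1, f 2, f 3, f 4]"
      using bij_betw_imp_inj_on[OF f(1)] by (auto simp: inj_on_def)
    show "F = ({f 0, f 1, f 2, f 3, f 4}, {{f 0, f 1}, {f 1, f 2}, {f 2, f 3}, {f 3, f 4}})"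
      using bij_betw_imp_surj_on[OF f(1)] f(2) by (intro prod_eqI) auto
  qed
qed

text \<open>Vertices and edges are listed in path order, the form in which
  \<open>graph_iso_P5\<close> applies.\<close>

lemma cell_graph_zigzag:
  "cell_graph (zigzag ((y1, y2), (x1, x2, x3))) =
     ({Inl x1, Inr y1, Inl x2, Inr y2, Inl x3},
      {{Inl x1, Inr y1}, {Inr y1, Inl x2}, {Inl x2, Inr y2}, {Inr y2, Inl x3}})"
  "cell_graph (prod.swap ` zigzag ((y1, y2), (x1, x2, x3))) =
     ({Inr x1, Inl y1, Inr x2, Inl y2, Inr x3},
      {{Inr x1, Inl y1}, {Inl y1, Inr x2}, {Inr x2, Inl y2}, {Inl y2, Inr x3}})"
  by (auto simp: cell_graph_def zigzag_def edge_of_def insert_commute)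

lemma copies_P5:
  "copies (path_graph 5) (complete_bipartite n n) =
     cell_graph ` (zigzag ` zigzags n \<union> (\<lambda>\<tau>. prod.swap ` zigzag \<tau>) ` zigzags n)"
proof
  show "copies (path_graph 5) (complete_bipartite n n) \<subseteq>
     cell_graph ` (zigzag ` zigzags n \<union> (\<lambda>\<tau>. prod.swap ` zigzag \<tau>) ` zigzags n)"
  proof
    fix F assume "F \<in> copies (path_graph 5) (complete_bipartite n n)"
    then have sub: "subgraph_of F (complete_bipartite n n)" and "graph_iso (path_graph 5) F"
      by (auto simp: copies_def)
    then obtain v0 v1 v2 v3 v4 where d: "distinct [v0, v1, v2, v3, v4]"
      and F: "F = ({v0, v1, v2, v3, v4}, {{v0, v1}, {v1, v2}, {v2, v3}, {v3, v4}})"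
      by (auto elim: graph_iso_P5E)
    have e: "\<exists>x<n. \<exists>y<n. (v = Inl x \<and> w = Inr y) \<or> (v = Inr y \<and> w = Inl x)"
      if "{v, w} \<in> edges F" for v w
      using sub that unfolding subgraph_of_def edges_complete_bipartite
      by (fastforce simp: edge_of_def doubleton_eq_iff)
    have E: "{v0, v1} \<in> edges F" "{v1, v2} \<in> edges F" "{v2, v3} \<in> edges F" "{v3, v4} \<in> edges F"
      by (simp_all add: F)
    show "F \<in> cell_graph ` (zigzag ` zigzags n \<union> (\<lambda>\<tau>. prod.swap ` zigzag \<tau>) ` zigzags n)"
    \<comment> \<open>A path alternates between the sides, so the side of its first vertex decides
      between zigzags and transposed zigzags.\<close>
    proof (cases v0)
      case (Inl x1)
      then obtain y1 x2 y2 x3 where v: "v1 = Inr y1" "v2 = Inl x2" "v3 = Inr y2" "v4 = Inl x3"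
        and lt: "x1 < n" "y1 < n" "x2 < n" "y2 < n" "x3 < n"
        using e[OF E(1)] e[OF E(2)] e[OF E(3)] e[OF E(4)] by auto
      consider "y1 < y2" | "y2 < y1" using d v by fastforce
      then have "\<exists>\<tau>\<in>zigzags n. F = cell_graph (zigzag \<tau>)"
      proof cases
        case 1
        then show ?thesis using d lt
          by (intro bexI[of _ "((y1, y2), (x1, x2, x3))"])
            (auto simp: F Inl v zigzags_def cell_graph_zigzag)
      next
        \<comment> \<open>The path is read backwards to put the smaller column first.\<close>
        case 2
        then show ?thesis using d lt
          by (intro bexI[of _ "((y2, y1), (x3, x2, x1))"])
            (auto simp: F Inl v zigzags_def cell_graph_zigzag)
      qed
      then show ?thesis by blast
    next
      case (Inr x1)
      then obtain y1 x2 y2 x3 where v: "v1 = Inl y1" "v2 = Inr x2" "v3 = Inl y2" "v4 = Inr x3"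
        and lt: "x1 < n" "y1 < n" "x2 < n" "y2 < n" "x3 < n"
        using e[OF E(1)] e[OF E(2)] e[OF E(3)] e[OF E(4)] by auto
      consider "y1 < y2" | "y2 < y1" using d v by fastforce
      then have "\<exists>\<tau>\<in>zigzags n. F = cell_graph (prod.swap ` zigzag \<tau>)"
      proof cases
        case 1
        then show ?thesis using d lt
          by (intro bexI[of _ "((y1, y2), (x1, x2, x3))"])
            (auto simp: F Inr v zigzags_def cell_graph_zigzag)
      next
        case 2
        then show ?thesis using d lt
          by (intro bexI[of _ "((y2, y1), (x3, x2, x1))"])
            (auto simp: F Inr v zigzags_def cell_graph_zigzag)
      qed
      then show ?thesis by blast
    qed
  qed
next
  have "cell_graph (zigzag \<tau>) \<in> copies (path_graph 5) (complete_bipartite n n)"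
    "cell_graph (prod.swap ` zigzag \<tau>) \<in> copies (path_graph 5) (complete_bipartite n n)"
    if t: "\<tau> \<in> zigzags n" for \<tau>
  proof -
    have "graph_iso (path_graph 5) (cell_graph (zigzag \<tau>))"
      "graph_iso (path_graph 5) (cell_graph (prod.swap ` zigzag \<tau>))"
      using t by (auto simp: zigzags_def cell_graph_zigzag intro!: graph_iso_P5)
    then show "cell_graph (zigzag \<tau>) \<in> copies (path_graph 5) (complete_bipartite n n)"
      "cell_graph (prod.swap ` zigzag \<tau>) \<in> copies (path_graph 5) (complete_bipartite n n)"
      using zigzag_subset[OF t] by (auto simp: copies_def intro!: subgraph_of_cell_graph)
  qed
  then show "cell_graph ` (zigzag ` zigzags n \<union> (\<lambda>\<tau>. prod.swap ` zigzag \<tau>) ` zigzags n) \<subseteq>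
     copies (path_graph 5) (complete_bipartite n n)" by blast
qed

lemma rainbow_cell_graph: "rainbow c (cell_graph C) \<longleftrightarrow> inj_on (c \<circ> edge_of) C"
  unfolding rainbow_def cell_graph_def
  using comp_inj_on_iff[OF inj_on_subset[OF inj_edge_of], of C c] by simp

lemma rainbow_copies_P5:
  "rainbow_copies c (path_graph 5) (complete_bipartite n n) =
     cell_graph ` (zigzag ` {\<tau> \<in> zigzags n. inj_on (c \<circ> edge_of) (zigzag \<tau>)} \<union>
       (\<lambda>\<tau>. prod.swap ` zigzag \<tau>) ` {\<tau> \<in> zigzags n. inj_on (c \<circ> edge_of \<circ> prod.swap) (zigzag \<tau>)})"
  unfolding rainbow_copies_def copies_P5 inj_on_comp_swap
  by (auto simp: rainbow_cell_graph)

text \<open>Rainbow and non-rainbow zigzags together exhaust both orientations. The additive form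
  avoids truncated subtraction.\<close>

lemma card_rainbow_copies_P5:
  "card (rainbow_copies c (path_graph 5) (complete_bipartite n n))
     + (card {\<tau> \<in> zigzags n. \<not> inj_on (c \<circ> edge_of) (zigzag \<tau>)}
        + card {\<tau> \<in> zigzags n. \<not> inj_on (c \<circ> edge_of \<circ> prod.swap) (zigzag \<tau>)})
   = n\<^sup>2 * (n - 1)\<^sup>2 * (n - 2)"
proof -
  let ?P = "\<lambda>\<tau>. inj_on (c \<circ> edge_of) (zigzag \<tau>)"
    and ?Q = "\<lambda>\<tau>. inj_on (c \<circ> edge_of \<circ> prod.swap) (zigzag \<tau>)"
  let ?A = "zigzag ` {\<tau> \<in> zigzags n. ?P \<tau>}" and ?B = "(\<lambda>\<tau>. prod.swap ` zigzag \<tau>) ` {\<tau> \<in> zigzags n. ?Q \<tau>}"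
  have A: "card ?A = card {\<tau> \<in> zigzags n. ?P \<tau>}"
    by (intro card_image inj_on_subset[OF inj_on_zigzag]) auto
  have "inj_on (\<lambda>\<tau>. prod.swap ` zigzag \<tau>) (zigzags n)"
    using inj_on_zigzag by (auto simp: inj_on_def inj_image_eq_iff[OF inj_swap])
  then have B: "card ?B = card {\<tau> \<in> zigzags n. ?Q \<tau>}"
    by (intro card_image) (auto elim: inj_on_subset)
  have "?A \<inter> ?B = {}" using zigzag_neq_swap by fastforce
  then have "card (?A \<union> ?B) = card ?A + card ?B"
    by (intro card_Un_disjoint) auto
  then have "card (rainbow_copies c (path_graph 5) (complete_bipartite n n)) =
      card {\<tau> \<in> zigzags n. ?P \<tau>} + card {\<tau> \<in> zigzags n. ?Q \<tau>}"
    unfolding rainbow_copies_P5 using A B by (simp add: card_image inj_on_subset[OF inj_cell_graph])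
  moreover have "card {\<tau> \<in> zigzags n. R \<tau>} + card {\<tau> \<in> zigzags n. \<not> R \<tau>} = card (zigzags n)" for R
    by (subst card_Un_disjoint[symmetric]) (auto intro!: arg_cong[of _ _ card])
  from this[of ?P] this[of ?Q] calculation show ?thesis unfolding card_zigzags[symmetric] by simp
qed

text \<open>The locale permits either order of the middle lines, whereas a zigzag needs
  \<open>y1 < y2\<close>; reversing the path covers the other order.\<close>

lemma rainbow_P5_free_coloring:
  assumes "rainbow_copies c (path_graph 5) (complete_bipartite n n) = {}"
  shows "rainbow_P5_free n (\<lambda>x y. c (edge_of (x, y)))"
proof
  let ?m = "c \<circ> edge_of"
  have no: "\<not> inj_on ?m (zigzag \<tau>)" "\<not> inj_on (?m \<circ> prod.swap) (zigzag \<tau>)" if "\<tau> \<in> zigzags n" for \<tau>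
    using assms that unfolding rainbow_copies_P5 by blast+
  have path: "\<not> distinct [m (x1, y1), m (x2, y1), m (x2, y2), m (x3, y2)]"
    if m: "\<And>\<tau>. \<tau> \<in> zigzags n \<Longrightarrow> \<not> inj_on m (zigzag \<tau>)"
    and x: "x1 < n" "x2 < n" "x3 < n" "y1 < n" "y2 < n" "distinct [x1, x2, x3]" "y1 \<noteq> y2"
    for x1 x2 x3 y1 y2 and m :: "nat \<times> nat \<Rightarrow> nat"
  proof
    assume d: "distinct [m (x1, y1), m (x2, y1), m (x2, y2), m (x3, y2)]"
    consider "y1 < y2" | "y2 < y1" using x(7) by linarith
    then show False
    proof cases
      case 1
      have "\<not> inj_on m (zigzag ((y1, y2), (x1, x2, x3)))"
        using x 1 by (intro m) (auto simp: zigzags_def)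
      then show False using d by (auto simp: zigzag_def inj_on_def)
    next
      case 2
      have "\<not> inj_on m (zigzag ((y2, y1), (x3, x2, x1)))"
        using x 2 by (intro m) (auto simp: zigzags_def)
      then show False using d by (auto simp: zigzag_def inj_on_def)
    qed
  qed
  show "\<not> distinct [c (edge_of (x1, y1)), c (edge_of (x2, y1)), c (edge_of (x2, y2)), c (edge_of (x3, y2))]"
    if "x1 < n" "x2 < n" "x3 < n" "y1 < n" "y2 < n" "distinct [x1, x2, x3]" "y1 \<noteq> y2"
    for x1 x2 x3 y1 y2
    using path[OF no(1) that] by simp
  show "\<not> distinct [c (edge_of (x1, y1)), c (edge_of (x1, y2)), c (edge_of (x2, y2)), c (edge_of (x2, y3))]"
    if "x1 < n" "x2 < n" "y1 < n" "y2 < n" "y3 < n" "distinct [y1, y2, y3]" "x1 \<noteq> x2"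
    for x1 x2 y1 y2 y3
    using path[OF no(2), of y1 y2 y3 x1 x2] that by simp
qed

section \<open>Monochromatic copies of substars\<close>

lemma embedding_copy:
  assumes H: "is_graph H" and K: "is_graph K"
    and "inj_on f (vertices H)" "\<And>e. e \<in> edges H \<Longrightarrow> f ` e \<in> edges K"
  shows "(f ` vertices H, (\<lambda>e. f ` e) ` edges H) \<in> copies H K" (is "?F \<in> _")
proof -
  have "card (f ` e) = 2" if "e \<in> edges H" for e
    using H that card_image[OF inj_on_subset[OF assms(3)]] by (metis is_graph_def)
  then have "is_graph ?F" using H by (fastforce simp: is_graph_def)
  moreover have "f ` vertices H \<subseteq> vertices K"
    using assms by (fastforce simp: is_graph_def)
  ultimately have "subgraph_of ?F K" using K assms(4) by (auto simp: subgraph_of_def)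
  moreover have "graph_iso H ?F" using assms(3) by (auto simp: graph_iso_def bij_betw_def)
  ultimately show ?thesis by (simp add: copies_def)
qed

lemma graph_iso_card_edges:
  assumes "graph_iso F G" "is_graph F"
  shows "card (edges F) = card (edges G)"
proof -
  obtain f where f: "bij_betw f (vertices F) (vertices G)" "(\<lambda>e. f ` e) ` edges F = edges G"
    using assms(1) by (auto simp: graph_iso_def)
  have "edges F \<subseteq> Pow (vertices F)" using assms(2) by (auto simp: is_graph_def)
  then have "inj_on (\<lambda>e. f ` e) (edges F)"
    using inj_on_image_Pow[OF bij_betw_imp_inj_on[OF f(1)]] by (rule inj_on_subset[rotated])
  then show ?thesis using f(2) card_image by metis
qed

text \<open>Four edges in \<open>H\<close> thereby force a large star and hence a large
  \<open>k\<close>.\<close>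

lemma card_edges_substar:
  assumes "graph_iso S (complete_bipartite 1 M)" "subgraph_of H S"
  shows "card (edges H) \<le> M"
proof -
  have S: "is_graph S" "edges H \<subseteq> edges S" using assms(2) by (auto simp: subgraph_of_def)
  then have "edges S \<subseteq> Pow (vertices S)" "finite (vertices S)" by (auto simp: is_graph_def)
  then have "finite (edges S)" using finite_subset by blast
  then have "card (edges H) \<le> card (edges S)" using S(2) by (simp add: card_mono)
  also have "\<dots> = card (edges (complete_bipartite 1 M))"
    using graph_iso_card_edges[OF assms(1) S(1)] .
  also have "edges (complete_bipartite 1 M) = (\<lambda>j. {Inl 0, Inr j}) ` {..<M}"
    by (auto simp: complete_bipartite_def)
  also have "card \<dots> \<le> M" using card_image_le[of "{..<M}" "\<lambda>j. {Inl 0, Inr j}"] by simp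
  finally show ?thesis .
qed

lemma monochromatic_star_copy:
  assumes iso: "graph_iso S (complete_bipartite 1 M)" and sub: "subgraph_of H S" and K: "is_graph K"
    and g: "inj_on g {..<M}" "w \<notin> g ` {..<M}"
    and E: "\<And>j. j < M \<Longrightarrow> {w, g j} \<in> edges K \<and> c {w, g j} = a"
  shows "monochromatic_copies c H K \<noteq> {}"
proof -
  obtain \<phi> where \<phi>: "bij_betw \<phi> (vertices S) (vertices (complete_bipartite 1 M))"
    "(\<lambda>e. \<phi> ` e) ` edges S = edges (complete_bipartite 1 M)"
    using iso by (auto simp: graph_iso_def)
  \<comment> \<open>The only left vertex of the star is its center, so a constant on that side is
    injective.\<close>
  define h where "h = case_sum (\<lambda>_ :: nat. w) g"
  have "inj_on h (vertices (complete_bipartite 1 M))"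
    using g by (auto simp: h_def complete_bipartite_def inj_on_def)
  then have "inj_on (h \<circ> \<phi>) (vertices S)"
    using \<phi>(1) by (auto simp: bij_betw_def intro: comp_inj_on)
  then have inj: "inj_on (h \<circ> \<phi>) (vertices H)"
    using sub by (auto simp: subgraph_of_def intro: inj_on_subset)
  have e: "(h \<circ> \<phi>) ` e \<in> edges K \<and> c ((h \<circ> \<phi>) ` e) = a" if "e \<in> edges H" for e
  proof -
    have "\<phi> ` e \<in> edges (complete_bipartite 1 M)" using that sub \<phi>(2) by (auto simp: subgraph_of_def)
    then obtain j where "j < M" "\<phi> ` e = {Inl 0, Inr j}" by (auto simp: complete_bipartite_def)
    moreover from this have "(h \<circ> \<phi>) ` e = {w, g j}"
      unfolding image_comp[symmetric] by (simp add: h_def)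
    ultimately show ?thesis using E by simp
  qed
  have "((h \<circ> \<phi>) ` vertices H, (\<lambda>e. (h \<circ> \<phi>) ` e) ` edges H) \<in> copies H K"
    using e sub by (intro embedding_copy inj K) (auto simp: subgraph_of_def)
  moreover have "monochromatic c ((h \<circ> \<phi>) ` vertices H, (\<lambda>e. (h \<circ> \<phi>) ` e) ` edges H)"
    using e unfolding monochromatic_def by (intro exI[of _ a]) auto
  ultimately show ?thesis by (auto simp: monochromatic_copies_def)
qed

text \<open>At least four edges of one color leave at most \<open>q - 2\<close> others, so at most
  \<open>q - 1\<close> colors would occur.\<close>

lemma no_monochromatic_copies:
  assumes "exact_coloring q K c" "card (edges K) = q + 2" "is_graph H" "4 \<le> card (edges H)"
  shows "monochromatic_copies c H K = {}"
proof (rule ccontr)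
  assume "monochromatic_copies c H K \<noteq> {}"
  then obtain F a where F: "subgraph_of F K" "graph_iso H F" "\<And>e. e \<in> edges F \<Longrightarrow> c e = a"
    by (auto simp: monochromatic_copies_def copies_def monochromatic_def)
  have fin: "finite (edges K)" using assms(2) by (intro card_ge_0_finite) simp
  have 4: "4 \<le> card (edges F)" using graph_iso_card_edges[OF F(2) assms(3)] assms(4) by simp
  have sub: "edges F \<subseteq> edges K" using F(1) by (simp add: subgraph_of_def)
  have "{1..q} \<subseteq> insert a (c ` (edges K - edges F))"
    using assms(1) F(3) unfolding exact_coloring_def by blast
  then have "q \<le> card (insert a (c ` (edges K - edges F)))"
    using card_mono[of "insert a (c ` (edges K - edges F))" "{1..q}"] fin by simp
  also have "\<dots> \<le> Suc (card (edges K - edges F))"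
    using card_image_le[of "edges K - edges F" c] fin by (simp add: card_insert_if)
  also have "card (edges K - edges F) = q + 2 - card (edges F)"
    using card_Diff_subset[OF finite_subset[OF sub fin] sub] assms(2) by simp
  finally show False using 4 card_mono[OF fin sub] assms(2) by linarith
qed

lemma star_coloring:
  assumes "3 \<le> t"
  obtains c where "exact_coloring (t\<^sup>2 - 2) (complete_bipartite t t) c"
    "c (edge_of (0, 0)) = 1" "c (edge_of (0, 1)) = 1" "c (edge_of (0, 2)) = 1"
proof -
  let ?A = "{..<t} \<times> {..<t}" and ?Z = "{(0, 0), (0, 1), (0, 2)} :: (nat \<times> nat) set"
  have t2: "3 * 3 \<le> t\<^sup>2" unfolding power2_eq_square by (intro mult_mono assms) auto
  have "card (?A - ?Z) = t\<^sup>2 - 3"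
    using assms by (subst card_Diff_subset) (auto simp: card_cartesian_product power2_eq_square)
  then have "card (?A - ?Z) = card {2..t\<^sup>2 - 2}" using t2 by simp
  then obtain h where h: "bij_betw h (?A - ?Z) {2..t\<^sup>2 - 2}"
    using finite_same_card_bij[of "?A - ?Z" "{2..t\<^sup>2 - 2}"] by auto
  define m where "m z = (if z \<in> ?Z then 1 else h z)" for z
  \<comment> \<open>Since \<open>edge_of\<close> is injective, its inverse transports a coloring of
    cells to edges.\<close>
  have c: "(m \<circ> inv edge_of) (edge_of z) = m z" for z by (simp add: inj_edge_of)
  have "?A = ?Z \<union> (?A - ?Z)" using assms by auto
  then have "m ` ?A = m ` ?Z \<union> m ` (?A - ?Z)" by blast
  also have "m ` ?Z = {1}" by (auto simp: m_def)
  also have "m ` (?A - ?Z) = h ` (?A - ?Z)" by (intro image_cong) (auto simp: m_def)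
  also have "\<dots> = {2..t\<^sup>2 - 2}" using h by (rule bij_betw_imp_surj_on)
  also have "{1} \<union> \<dots> = {1..t\<^sup>2 - 2}" using t2 by auto
  finally have "exact_coloring (t\<^sup>2 - 2) (complete_bipartite t t) (m \<circ> inv edge_of)"
    unfolding exact_coloring_def edges_complete_bipartite image_image c .
  then show thesis using that[of "m \<circ> inv edge_of"] unfolding c by (simp add: m_def)
qed

lemma rainbow_P5_or_monochromatic_star:
  assumes "exact_coloring q (complete_bipartite n n) c" "9 \<le> q" "2 * M \<le> q"
    and "graph_iso S (complete_bipartite 1 M)" "subgraph_of H S"
  shows "rainbow_copies c (path_graph 5) (complete_bipartite n n) \<noteq> {} \<or>
    monochromatic_copies c H (complete_bipartite n n) \<noteq> {}"
proof (cases "rainbow_copies c (path_graph 5) (complete_bipartite n n) = {}")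
  case True
  then interpret rainbow_P5_free n "\<lambda>x y. c (edge_of (x, y))"
    using rainbow_P5_free_coloring by simp
  have "colours = c ` edges (complete_bipartite n n)"
    by (auto simp: edges_complete_bipartite colours_def row_def)
  then have q: "card colours = q" using assms(1) by (simp add: exact_coloring_def)
  \<comment> \<open>From \<open>2 * M \<le> q \<le> n + 1 \<le> 2 * card Y + 1\<close> parity
    removes the extra 1.\<close>
  have star: "M \<le> card Y" if "n \<le> 2 * card Y" for Y :: "nat set"
    using that heavy_star(1) q assms(2,3) by linarith
  have numbering: "\<exists>g. inj_on g {..<M} \<and> g ` {..<M} \<subseteq> Y" if "finite Y" "M \<le> card Y" for Y :: "nat set"
    using card_le_inj[of "{..<M}" Y] that by auto
  from heavy_star(2) q assms(2) have "heavy_row \<or> heavy_column" by simp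
  then have "monochromatic_copies c H (complete_bipartite n n) \<noteq> {}"
  proof
    assume heavy_row
    then obtain x a where x: "x < n" "n \<le> 2 * card {y. y < n \<and> c (edge_of (x, y)) = a}"
      unfolding heavy_row_def by blast
    then obtain g where g: "inj_on g {..<M}" "g ` {..<M} \<subseteq> {y. y < n \<and> c (edge_of (x, y)) = a}"
      using numbering[OF _ star[OF x(2)]] by auto
    show ?thesis
    proof (rule monochromatic_star_copy[OF assms(4,5) is_graph_complete_bipartite])
      show "inj_on (Inr \<circ> g) {..<M}" using g(1) by (auto simp: inj_on_def)
      show "Inl x \<notin> (Inr \<circ> g) ` {..<M}" by auto
      show "{Inl x, (Inr \<circ> g) j} \<in> edges (complete_bipartite n n) \<and> c {Inl x, (Inr \<circ> g) j} = a"
        if "j < M" for j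
        using g(2) that x(1) by (auto simp: complete_bipartite_def edge_of_def)
    qed
  next
    assume heavy_column
    then obtain y a where y: "y < n" "n \<le> 2 * card {x. x < n \<and> c (edge_of (x, y)) = a}"
      unfolding heavy_column_def by blast
    then obtain g where g: "inj_on g {..<M}" "g ` {..<M} \<subseteq> {x. x < n \<and> c (edge_of (x, y)) = a}"
      using numbering[OF _ star[OF y(2)]] by auto
    show ?thesis
    proof (rule monochromatic_star_copy[OF assms(4,5) is_graph_complete_bipartite])
      show "inj_on (Inl \<circ> g) {..<M}" using g(1) by (auto simp: inj_on_def)
      show "Inr y \<notin> (Inl \<circ> g) ` {..<M}" by auto
      show "{Inr y, (Inl \<circ> g) j} \<in> edges (complete_bipartite n n) \<and> c {Inr y, (Inl \<circ> g) j} = a"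
        if "j < M" for j
        using g(2) that y(1) by (auto simp: complete_bipartite_def edge_of_def insert_commute)
    qed
  qed
  then show ?thesis ..
qed simp

theorem theorem4p6:
  fixes k t :: nat and H S :: "'a ugraph"
  assumes "k = t\<^sup>2" and "k \<ge> 9"
    and "graph_iso S (complete_bipartite 1 (nat \<lceil>(real k - 3) / 2\<rceil>))"
    and "subgraph_of H S"
    and "card (edges H) \<ge> 4"
  shows "int (bi_GM (k - 2) (path_graph 5) H) =
    int t ^ 2 * (int t - 1) ^ 2 * (int t - 2) - 9 * (int t - 1) * (int t - 2)"
proof -
  let ?M = "nat \<lceil>(real k - 3) / 2\<rceil>"
  \<comment> \<open>The four edges of \<open>H\<close> exclude \<open>k = 9\<close>; as
    \<open>k\<close> is a square, it is at least 16, which leaves more than nine colors.\<close>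
  have "4 \<le> ?M" using card_edges_substar[OF assms(3,4)] assms(5) by linarith
  then have "3 < \<lceil>(real k - 3) / 2\<rceil>" by linarith
  then have "10 \<le> k" by (simp add: less_ceiling_iff)
  have t: "4 \<le> t"
  proof (rule ccontr)
    assume "\<not> 4 \<le> t"
    then have "t\<^sup>2 \<le> 3\<^sup>2" by (intro power_mono) auto
    then show False using \<open>10 \<le> k\<close> assms(1) by simp
  qed
  then have "4\<^sup>2 \<le> t\<^sup>2" by (intro power_mono) auto
  then have k: "16 \<le> k" using assms(1) by simp
  \<comment> \<open>A ceiling exceeds its argument by less than 1, so twice the star size is below
    \<open>k - 1\<close>.\<close>
  have "real_of_int (2 * \<lceil>(real k - 3) / 2\<rceil>) < real_of_int (int k - 1)"
    using ceiling_correct[of "(real k - 3) / 2"] by simp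
  then have "2 * \<lceil>(real k - 3) / 2\<rceil> < int k - 1" by (simp only: of_int_less_iff)
  then have M: "2 * ?M \<le> k - 2" using k by linarith
  have t3: "3 \<le> t" using t by simp
  have H: "is_graph H" using assms(4) by (simp add: subgraph_of_def)
  have bgr: "bgr (k - 2) (path_graph 5) H = t"
    unfolding bgr_def
  proof (rule Least_equality)
    show "k - 2 \<le> t\<^sup>2 \<and> (\<forall>n\<ge>t. \<forall>c. exact_coloring (k - 2) (complete_bipartite n n) c \<longrightarrow>
        rainbow_copies c (path_graph 5) (complete_bipartite n n) \<noteq> {} \<or>
        monochromatic_copies c H (complete_bipartite n n) \<noteq> {})"
      using rainbow_P5_or_monochromatic_star[OF _ _ M assms(3,4)] k assms(1) by auto
  next
    fix N assume "k - 2 \<le> N\<^sup>2 \<and> (\<forall>n\<ge>N. \<forall>c. exact_coloring (k - 2) (complete_bipartite n n) c \<longrightarrow>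
        rainbow_copies c (path_graph 5) (complete_bipartite n n) \<noteq> {} \<or>
        monochromatic_copies c H (complete_bipartite n n) \<noteq> {})"
    then have N: "k - 2 \<le> N\<^sup>2" by blast
    show "t \<le> N"
    proof (rule ccontr)
      assume "\<not> t \<le> N"
      \<comment> \<open>Squares of consecutive numbers differ by \<open>2 * N + 1\<close>, but
        \<open>k\<close> exceeds \<open>N\<^sup>2\<close> by at most 2; so \<open>N\<close> would be
        0.\<close>
      then have "(N + 1)\<^sup>2 \<le> t\<^sup>2" by (intro power_mono) auto
      then have "2 * N \<le> 1" using N assms(1) by (simp add: power2_eq_square)
      then have "N\<^sup>2 \<le> 0" by simp
      then show False using N k by simp
    qed
  qed
  let ?K = "complete_bipartite t t" and ?V = "t\<^sup>2 * (t - 1)\<^sup>2 * (t - 2) - 9 * ((t - 1) * (t - 2))"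
  let ?count = "\<lambda>c. card (rainbow_copies c (path_graph 5) ?K) + card (monochromatic_copies c H ?K)"
  have mono: "monochromatic_copies c H ?K = {}" if "exact_coloring (k - 2) ?K c" for c
    using no_monochromatic_copies[OF that _ H assms(5)] k assms(1)
    by (simp add: card_edges_complete_bipartite)
  have lower: "?V \<le> ?count c" if c: "exact_coloring (k - 2) ?K c" for c
  proof -
    have "(c \<circ> edge_of) ` ({..<t} \<times> {..<t}) = {1..k - 2}"
      using c by (simp add: exact_coloring_def edges_complete_bipartite image_comp)
    then have "t\<^sup>2 = card ((c \<circ> edge_of) ` ({..<t} \<times> {..<t})) + 2" using k assms(1) by simp
    from repeated_zigzags_le[OF t3 this] show ?thesis
      using card_rainbow_copies_P5[of c t] by linarith
  qed
  obtain c where c: "exact_coloring (k - 2) ?K c"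
    "c (edge_of (0, 0)) = 1" "c (edge_of (0, 1)) = 1" "c (edge_of (0, 2)) = 1"
    using star_coloring[OF t3] assms(1) by metis
  have "9 * ((t - 1) * (t - 2)) \<le> card {\<tau> \<in> zigzags t. \<not> inj_on (c \<circ> edge_of) (zigzag \<tau>)}
      + card {\<tau> \<in> zigzags t. \<not> inj_on (c \<circ> edge_of \<circ> prod.swap) (zigzag \<tau>)}"
    using repeated_zigzags_star[OF t3, of "c \<circ> edge_of" 1] c by simp
  \<comment> \<open>The inequality \<open>le\<close> shows that the subtraction in \<open>?V\<close>
    does not truncate, as the final passage to integers requires.\<close>
  then have upper: "?count c \<le> ?V" and le: "9 * ((t - 1) * (t - 2)) \<le> t\<^sup>2 * (t - 1)\<^sup>2 * (t - 2)"
    using card_rainbow_copies_P5[of c t] arg_cong[OF mono[OF c(1)], of card] unfolding card.empty by linarith+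
  have "bi_GM (k - 2) (path_graph 5) H = ?V"
    unfolding bi_GM_def bgr Let_def
  proof (rule cInf_eq_minimum)
    show "?V \<in> ?count ` {c. exact_coloring (k - 2) ?K c}"
      using c(1) upper lower by (intro image_eqI[of _ _ c]) (auto intro: order_antisym)
  qed (use lower in auto)
  then show ?thesis using le t by (simp add: of_nat_diff)
qed

end
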